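(* Let $q\in\mathbb{N}$. Let $A(y)=\sum_{n=0}^{\infty}a_ny^n$ and $B(y)=\sum_{n=0}^{\infty}b_ny^n$ be formal power series in one variable over $\mathbb{R}$ and let $P(x)=\sum_{c\in C}P_cX^c$ be a formal power series in $q$ variables over $\mathbb{R}$, such that all coefficients of $A$, $B$ and $P$ belong to $\mathbb{R}_+=[0,\infty)$. If both compositions $A\circ P$ and $B\circ P$ exist, then the General Multivariable Right Distributive Law holds: the composition $(AB)\circ P$ exists and $$(A\circ P)(B\circ P)=(AB)\circ P.$$
   Context: $\mathbb{N}$ is the set of positive integers, $\mathbb{N}_0=\mathbb{N}\cup\{0\}$, and $C:=\mathbb{N}_0^q$. A formal power series in $q$ variables $x=(x_1,\ldots,x_q)$ over $\mathbb{R}$ is a formal sum $f(x)=\sum_{c\in C}f_cX^c$ with $f_c\in\mathbb{R}$ and $X^c=x_1^{c_1}\cdots x_q^{c_q}$; it is identified with the map $c\mapsto f_c$. The product is the Cauchy product $(fg)_c=\sum_{a,b\in C,\ a+b=c}f_ag_b$ (for one variable, $(AB)_n=\sum_{j=0}^na_jb_{n-j}$). Powers: $f^0:=I$, where $I_{(0,\ldots,0)}=1$ and $I_c=0$ otherwise, and $f^n$ is the $n$-fold Cauchy product of $f$ with itself. Composition: for a one-variable series $A(y)=\sum_{n=0}^\infty a_ny^n$ and a $q$-variable series $P$, the composition $A\circ P$ is said to exist if for every $c\in C$ the series $\sum_{n=0}^{\infty}a_n(P^n)_c$ converges in $\mathbb{R}$; in that case $A\circ P$ is the $q$-variable formal power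 series with coefficients $(A\circ P)_c:=\sum_{n=0}^{\infty}a_n(P^n)_c$. *)

theory Defs
  imports "HOL-Analysis.Finite_Cartesian_Product"
    "HOL-Computational_Algebra.Formal_Power_Series"
begin

(* Power series in several variables with real coefficients, identified with their coefficient
   maps. The variables are indexed by the finite type 'q, so CARD('q) is the number of variables,
   and exponents are elements of nat ^ 'q with componentwise zero and addition.
   One-variable series are of type real fps, whose multiplication is the Cauchy product. *)
type_synonym 'q mfps = "nat ^ 'q \<Rightarrow> real"

definition mfps_one :: "'q::finite mfps" where
  "mfps_one = (\<lambda>c. if c = 0 then 1 else 0)"

definition mfps_mult :: "'q::finite mfps \<Rightarrow> 'q mfps \<Rightarrow> 'q mfps" where
  "mfps_mult f g = (\<lambda>c. \<Sum>(a, b) \<in> {(a, b). a + b = c}. f a * g b)"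

primrec mfps_power :: "'q::finite mfps \<Rightarrow> nat \<Rightarrow> 'q mfps" where
  "mfps_power f 0 = mfps_one"
| "mfps_power f (Suc n) = mfps_mult f (mfps_power f n)"

definition compose_exists :: "real fps \<Rightarrow> 'q::finite mfps \<Rightarrow> bool" where
  "compose_exists A P \<longleftrightarrow> (\<forall>c. summable (\<lambda>n. fps_nth A n * mfps_power P n c))"

(* Only meaningful when compose_exists A P holds: suminf is unspecified otherwise. *)
definition mfps_compose :: "real fps \<Rightarrow> 'q::finite mfps \<Rightarrow> 'q mfps" where
  "mfps_compose A P = (\<lambda>c. \<Sum>n. fps_nth A n * mfps_power P n c)"

(* The index set of the Cauchy product is finite, so its sum is never 0 by convention. *)
lemma finite_exponent_splittings: "finite {(a, b). a + b = (c :: nat ^ 'q::finite)}"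
proof -
  let ?F = "{f :: 'q \<Rightarrow> nat. \<forall>i. f i \<in> {..c $ i}}"
  have "finite ?F"
    using finite_PiE[of UNIV "\<lambda>i. {..c $ i}"] by (simp add: PiE_def Pi_def)
  then have "finite ((\<lambda>(f, g). (vec_lambda f, vec_lambda g)) ` (?F \<times> ?F))"
    by blast
  moreover have "{(a, b). a + b = c} \<subseteq> (\<lambda>(f, g). (vec_lambda f, vec_lambda g)) ` (?F \<times> ?F)"
  proof clarify
    fix a b :: "nat ^ 'q" assume "c = a + b"
    show "(a, b) \<in> (\<lambda>(f, g). (vec_lambda f, vec_lambda g)) `
            ({f. \<forall>i. f i \<in> {..(a + b) $ i}} \<times> {f. \<forall>i. f i \<in> {..(a + b) $ i}})"
      by (rule image_eqI[of _ _ "(vec_nth a, vec_nth b)"]) auto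
  qed
  ultimately show ?thesis by (rule rev_finite_subset)
qed

end

(* Each coefficient of (A o P)(B o P) is a finite sum of products of two series with nonnegative,
   hence absolutely summable, terms. Mertens' theorem turns each product into a Cauchy product
   sum over k; interchanging the finite sums and using P^i P^(k-i) = P^k identifies the k-th term
   of the total with (AB)_k (P^k)_c. *)
theory Submission
  imports Defs
begin

lemma mfps_mult_one_left: "mfps_mult mfps_one f = (f :: 'q::finite mfps)"
proof
  fix c
  \<comment> \<open>\<open>mfps_one\<close> vanishes away from 0, and \<open>0 + b = c\<close>
    forces \<open>b = c\<close>, so only one splitting contributes.\<close>
  have "mfps_mult mfps_one f c = (\<Sum>(a, b) \<in> {(0 :: nat ^ 'q, c)}. mfps_one a * f b)"
    unfolding mfps_mult_def
    by (rule sum.mono_neutral_right[OF finite_exponent_splittings]) (auto simp: mfps_one_def split: if_splits)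
  then show "mfps_mult mfps_one f c = f c"
    by (simp add: mfps_one_def)
qed

text \<open>Both bracketings sum over the ordered splittings of \<open>c\<close> into three
  exponents.\<close>

lemma mfps_mult_assoc: "mfps_mult (mfps_mult f g) h = mfps_mult f (mfps_mult g h)"
proof
  fix c
  let ?S = "\<lambda>c. {(a, b). a + b = c}"
  have "mfps_mult (mfps_mult f g) h c =
      (\<Sum>x \<in> ?S c. \<Sum>y \<in> ?S (fst x). f (fst y) * g (snd y) * h (snd x))"
    by (simp add: mfps_mult_def sum_distrib_right case_prod_beta)
  also have "\<dots> = (\<Sum>(x, y) \<in> (SIGMA x : ?S c. ?S (fst x)). f (fst y) * g (snd y) * h (snd x))"
    by (rule sum.Sigma) (auto simp: finite_exponent_splittings)
  also have "\<dots> = (\<Sum>(x, y) \<in> (SIGMA x : ?S c. ?S (snd x)). f (fst x) * (g (fst y) * h (snd y)))"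
    \<comment> \<open>The first witness turns a split of the right summand into one of the left
      summand, regrouping \<open>u + (s + t)\<close> as \<open>(u + s) + t\<close>; the second is
      its inverse.\<close>
    by (rule sum.reindex_bij_witness
          [of _ "\<lambda>((u, v), (s, t)). ((u + s, t), (u, s))" "\<lambda>((u, v), (s, t)). ((s, t + v), (t, v))"])
       (auto simp: ac_simps)
  also have "\<dots> = (\<Sum>x \<in> ?S c. \<Sum>y \<in> ?S (snd x). f (fst x) * (g (fst y) * h (snd y)))"
    by (rule sum.Sigma[symmetric]) (auto simp: finite_exponent_splittings)
  also have "\<dots> = mfps_mult f (mfps_mult g h) c"
    by (simp add: mfps_mult_def sum_distrib_left case_prod_beta)
  finally show "mfps_mult (mfps_mult f g) h c = mfps_mult f (mfps_mult g h) c" .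
qed

lemma mfps_power_add: "mfps_mult (mfps_power f m) (mfps_power f n) = mfps_power f (m + n)"
  by (induction m) (simp_all add: mfps_mult_one_left mfps_mult_assoc)

lemma mfps_power_nonneg:
  assumes "\<And>c. f c \<ge> 0"
  shows "mfps_power f n c \<ge> 0"
  by (induction n arbitrary: c)
     (auto simp: mfps_one_def mfps_mult_def assms intro!: sum_nonneg mult_nonneg_nonneg)

text \<open>Stated with \<open>sums\<close> so that it yields both the existence of the composition
  and its value.\<close>

lemma mfps_compose_mult_sums:
  assumes "\<And>n. fps_nth A n \<ge> 0" and "\<And>n. fps_nth B n \<ge> 0" and "\<And>c. P c \<ge> 0"
    and "compose_exists A P" and "compose_exists B P"
  shows "(\<lambda>n. fps_nth (A * B) n * mfps_power P n c) sums
           mfps_mult (mfps_compose A P) (mfps_compose B P) c"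
proof -
  let ?t = "\<lambda>F n c. fps_nth F n * mfps_power P n c"
  let ?S = "{(a, b). a + b = c}"
  have "(\<lambda>k. \<Sum>i\<le>k. ?t A i a * ?t B (k - i) b) sums (mfps_compose A P a * mfps_compose B P b)"
    for a b
    unfolding mfps_compose_def using assms
    \<comment> \<open>Both series must converge absolutely; since their terms are nonnegative, this
      is the existence of the compositions at \<open>a\<close> and \<open>b\<close>.\<close>
    by (intro Cauchy_product_sums) (auto simp: compose_exists_def mfps_power_nonneg abs_mult)
  then have "(\<lambda>k. \<Sum>(a, b) \<in> ?S. \<Sum>i\<le>k. ?t A i a * ?t B (k - i) b) sums
      (\<Sum>(a, b) \<in> ?S. mfps_compose A P a * mfps_compose B P b)"
    unfolding case_prod_beta by (intro sums_sum)
  moreover have "(\<Sum>(a, b) \<in> ?S. \<Sum>i\<le>k. ?t A i a * ?t B (k - i) b) = ?t (A * B) k c" for k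
  proof -
    have "(\<Sum>(a, b) \<in> ?S. \<Sum>i\<le>k. ?t A i a * ?t B (k - i) b) =
        (\<Sum>i\<le>k. fps_nth A i * fps_nth B (k - i) *
          mfps_mult (mfps_power P i) (mfps_power P (k - i)) c)"
      unfolding case_prod_beta mfps_mult_def
      by (subst sum.swap) (simp add: sum_distrib_left mult_ac)
    also have "\<dots> = ?t (A * B) k c"
      \<comment> \<open>For \<open>i \<le> k\<close> the truncated \<open>k - i\<close> is exact, so
        each product of powers is \<open>mfps_power P k\<close>, which factors out of the sum over
        \<open>i\<close>.\<close>
      by (simp add: mfps_power_add fps_mult_nth sum_distrib_right atLeast0AtMost)
    finally show ?thesis .
  qed
  ultimately show ?thesis
    by (simp add: mfps_mult_def)
qed

theorem theorem20:
  fixes A B :: "real fps" and P :: "'q::finite mfps"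
  assumes "\<And>n. fps_nth A n \<ge> 0" and "\<And>n. fps_nth B n \<ge> 0" and "\<And>c. P c \<ge> 0"
    and "compose_exists A P" and "compose_exists B P"
  shows "compose_exists (A * B) P \<and>
         mfps_mult (mfps_compose A P) (mfps_compose B P) = mfps_compose (A * B) P"
  using mfps_compose_mult_sums[OF assms]
  \<comment> \<open>Only the composition with \<open>A * B\<close> is unfolded; the two factors stay
    folded to match the sum supplied by the lemma.\<close>
  by (auto simp: compose_exists_def mfps_compose_def[of "A * B"] sums_iff)

end
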